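(* Let $P\subset\mathbb{R}^d$ be a centrally symmetric lattice polytope. Then, for every $c\in\mathbb{Q}^d$, the Ehrhart quasi-polynomial $L_{c+P}(t)$ is symmetric.
   Context: A lattice polytope (resp. rational polytope) is the convex hull of finitely many (at least one) points of $\mathbb{R}^d$ all of whose vertices lie in $\mathbb{Z}^d$ (resp. $\mathbb{Q}^d$). A polytope $P$ is centrally symmetric if there exists $c\in\mathbb{R}^d$ with $P=c+(-P)$. A quasi-polynomial is a function $L$ on the positive integers for which there are an integer $\rho>0$ (a period) and polynomials $f_1,\dots,f_\rho\in\mathbb{Q}[x]$ (the constituents) such that $L(t)=f_k(t)$ whenever $t\equiv k \pmod \rho$; one also writes $f_0:=f_\rho$. The minimal period is the smallest possible period. For a rational polytope $Q\subset\mathbb{R}^d$, the function $L_Q(t):=\#(tQ\cap\mathbb{Z}^d)$, $t\in\mathbb{Z}_{>0}$, is a quasi-polynomial, called the Ehrhart quasi-polynomial of $Q$. A quasi-polynomial with period $\rho$ and constituents $f_0=f_\rho,f_1,\dots,f_{\rho-1}$ is symmetric if $f_k=f_{\rho-k}$ for all $0\le k\le\rho$. By convention $\rho$ is the minimal period (the notion does not depend on which period is used). *)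

theory Defs
  imports "HOL-Analysis.Analysis" "HOL-Computational_Algebra.Polynomial" "HOL-Number_Theory.Cong"
begin

definition integer_points :: "(real ^ 'd) set" where
  "integer_points = {x. \<forall>i. x $ i \<in> \<int>}"

definition rational_points :: "(real ^ 'd) set" where
  "rational_points = {x. \<forall>i. x $ i \<in> \<rat>}"

definition lattice_polytope :: "(real ^ 'd) set \<Rightarrow> bool" where
  "lattice_polytope P \<longleftrightarrow>
     polytope P \<and> P \<noteq> {} \<and> (\<forall>v. v extreme_point_of P \<longrightarrow> v \<in> integer_points)"

definition centrally_symmetric :: "'a::ab_group_add set \<Rightarrow> bool" where
  "centrally_symmetric P \<longleftrightarrow> (\<exists>c. P = (+) c ` (uminus ` P))"

(* Only the values at t > 0 are meaningful. *)
definition ehrhart :: "(real ^ 'd) set \<Rightarrow> nat \<Rightarrow> rat" where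
  "ehrhart Q t = of_nat (card ((*\<^sub>R) (real t) ` Q \<inter> integer_points))"

(* A function on the positive integers is represented by a function on nat whose value at 0 is
   ignored.  For given L and p, the polynomials f 0, ..., f p are uniquely determined, since each
   residue class contains infinitely many positive integers; f k is irrelevant for k > p. *)
definition has_constituents :: "(nat \<Rightarrow> rat) \<Rightarrow> nat \<Rightarrow> (nat \<Rightarrow> rat poly) \<Rightarrow> bool" where
  "has_constituents L p f \<longleftrightarrow>
     p > 0 \<and> f 0 = f p \<and>
     (\<forall>k\<in>{1..p}. \<forall>t>0. [t = k] (mod p) \<longrightarrow> L t = poly (f k) (of_nat t))"

definition quasi_period :: "(nat \<Rightarrow> rat) \<Rightarrow> nat \<Rightarrow> bool" where
  "quasi_period L p \<longleftrightarrow> (\<exists>f. has_constituents L p f)"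

definition quasi_polynomial :: "(nat \<Rightarrow> rat) \<Rightarrow> bool" where
  "quasi_polynomial L \<longleftrightarrow> (\<exists>p. quasi_period L p)"

definition minimal_period :: "(nat \<Rightarrow> rat) \<Rightarrow> nat" where
  "minimal_period L = (LEAST p. quasi_period L p)"

definition symmetric_quasi_polynomial :: "(nat \<Rightarrow> rat) \<Rightarrow> bool" where
  "symmetric_quasi_polynomial L \<longleftrightarrow>
     quasi_polynomial L \<and>
     (\<exists>f. has_constituents L (minimal_period L) f \<and>
          (\<forall>k\<le>minimal_period L. f k = f (minimal_period L - k)))"

end

theory Submission
  imports Defs
begin

text \<open>
  Write \<open>G v t\<close> for the number of integer points of \<open>v + t P\<close>.  The Ehrhart function of
  \<open>c + P\<close> is \<open>t \<mapsto> G (t c) t\<close>, and \<open>G\<close> is invariant under translating \<open>v\<close> by an integer vector.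
  So if \<open>p c\<close> is an integer vector, then on the residue class of \<open>k\<close> modulo \<open>p\<close> the Ehrhart function
  is \<open>t \<mapsto> G (k c) t\<close>.  Two facts remain.

  \<^item> For every real \<open>v\<close>, \<open>G v\<close> agrees with a polynomial at all positive integers
    (\<open>translate_count_polynomial\<close>).
  \<^item> \<open>G (- v) = G v\<close> when \<open>P\<close> is centrally symmetric (\<open>translate_count_uminus\<close>): if \<open>P = w - P\<close>,
    then \<open>w\<close> is a sum of two vertices, hence an integer vector, and \<open>y \<mapsto> t w - y\<close> exchanges the
    integer points of \<open>- v + t P\<close> and \<open>v + t P\<close>.

  Since the residue classes of \<open>k\<close> and \<open>- k\<close> carry \<open>G (k c)\<close> and \<open>G (- k c)\<close>, the second fact
  is the asserted symmetry.  It passes from the period \<open>p\<close> to the minimal period because a constituent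
  is determined by its values on any infinite progression in its residue class.

  The first fact is a form of Ehrhart's theorem.  Let \<open>P\<close> be the convex hull of integer points
  \<open>a 0, \<dots>, a (n - 1)\<close>.  A point of \<open>t P\<close> is a combination \<open>\<Sum> l i a i\<close> with nonnegative
  coefficients of sum \<open>t\<close>, in general in many ways; the lexicographically least coefficient vector is
  a canonical choice.  The key observation is that whether \<open>l\<close> is lexicographically least depends
  only on its support (\<open>lex_least_representation_iff\<close>).  The admissible supports thus play the part
  of a triangulation of \<open>P\<close> into relatively open simplices, and no polyhedral subdivision has to be
  constructed.  As the support is all that matters, a canonical \<open>l\<close> splits uniquely as
  \<open>b + m\<close> with \<open>b\<close> canonical of the same support and values in the half-open interval from 0 (excluded)
  to 1 (included) there, and with \<open>m\<close> integral.
  Because the \<open>a i\<close> are integral, \<open>l\<close> yields an integer point of \<open>v + t P\<close> iff \<open>b\<close> does.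
  There are finitely many such \<open>b\<close>, and for each the number of \<open>m\<close> with the right sum is a binomial
  coefficient, a polynomial in \<open>t\<close>.
\<close>

section \<open>Lexicographically least convex coefficients\<close>

definition lex_less :: "(nat \<Rightarrow> real) \<Rightarrow> (nat \<Rightarrow> real) \<Rightarrow> bool" where
  "lex_less l m \<longleftrightarrow> (\<exists>j. (\<forall>i<j. l i = m i) \<and> l j < m j)"

definition lex_least :: "(nat \<Rightarrow> real) \<Rightarrow> (nat \<Rightarrow> real) set \<Rightarrow> bool" where
  "lex_least l K \<longleftrightarrow> l \<in> K \<and> (\<forall>m\<in>K. \<not> lex_less m l)"

definition supp :: "(nat \<Rightarrow> 'a::zero) \<Rightarrow> nat set" where
  "supp l = {i. l i \<noteq> 0}"

definition representations ::
    "nat \<Rightarrow> (nat \<Rightarrow> 'e::real_vector) \<Rightarrow> 'e \<Rightarrow> real \<Rightarrow> (nat \<Rightarrow> real) set" where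
  "representations n a x t =
     {l. (\<forall>i. 0 \<le> l i) \<and> (\<forall>i\<ge>n. l i = 0) \<and>
         (\<Sum>i<n. l i) = t \<and> (\<Sum>i<n. l i *\<^sub>R a i) = x}"

text \<open>
  A vector \<open>r\<close> as excluded here is a direction in which a representation with support \<open>S\<close> can be moved
  a little, keeping the point, the sum and nonnegativity, so as to become lexicographically smaller.
\<close>

definition unimprovable :: "nat \<Rightarrow> (nat \<Rightarrow> 'e::real_vector) \<Rightarrow> nat set \<Rightarrow> bool" where
  "unimprovable n a S \<longleftrightarrow>
     \<not> (\<exists>r. (\<forall>i\<ge>n. r i = 0) \<and> (\<Sum>i<n. r i) = 0 \<and> (\<Sum>i<n. r i *\<^sub>R a i) = 0 \<and>
            (\<forall>i. i \<notin> S \<longrightarrow> 0 \<le> r i) \<and> lex_less r (\<lambda>_. 0))"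

lemma lex_less_total:
  assumes "l \<noteq> m"
  shows "lex_less l m \<or> lex_less m l"
proof -
  define j where "j = (LEAST i. l i \<noteq> m i)"
  have "\<exists>i. l i \<noteq> m i" using assms by auto
  then have "l j \<noteq> m j" unfolding j_def by (rule LeastI_ex)
  moreover have "l i = m i" if "i < j" for i
    using that not_less_Least unfolding j_def by blast
  ultimately show ?thesis
    unfolding lex_less_def by (metis linorder_neqE)
qed

lemma lex_least_unique:
  assumes "lex_least l K" and "lex_least m K"
  shows "l = m"
  using assms lex_less_total unfolding lex_least_def by blast

text \<open>
  Minimising the coordinates one after the other keeps the set compact and nonempty; all choices
  are made once the coordinates below \<open>n\<close> are exhausted.
\<close>

lemma lex_least_exists:
  fixes K :: "(nat \<Rightarrow> real) set"
  assumes "compact K" and "K \<noteq> {}" and zero: "\<And>l i. l \<in> K \<Longrightarrow> n \<le> i \<Longrightarrow> l i = 0"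
  shows "\<exists>l. lex_least l K"
proof -
  \<comment> \<open>\<open>M\<close> consists of the elements of \<open>K\<close> whose first \<open>m\<close> coordinates are lexicographically least.\<close>
  have "\<exists>M\<subseteq>K. compact M \<and> M \<noteq> {} \<and>
     (\<forall>l\<in>M. \<forall>u\<in>K. (\<forall>j<m. (\<forall>i<j. u i = l i) \<longrightarrow> l j \<le> u j) \<and> ((\<forall>i<m. u i = l i) \<longrightarrow> u \<in> M))" for m
  proof (induction m)
    case 0
    then show ?case using assms by auto
  next
    case (Suc m)
    then obtain M where M: "M \<subseteq> K" "compact M" "M \<noteq> {}"
      and least: "\<And>l u j. l \<in> M \<Longrightarrow> u \<in> K \<Longrightarrow> j < m \<Longrightarrow> (\<forall>i<j. u i = l i) \<Longrightarrow> l j \<le> u j"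
      and ext: "\<And>l u. l \<in> M \<Longrightarrow> u \<in> K \<Longrightarrow> (\<forall>i<m. u i = l i) \<Longrightarrow> u \<in> M"
      by metis
    have cont: "continuous_on UNIV (\<lambda>l::nat \<Rightarrow> real. l m)" by simp
    obtain k where k: "k \<in> M" "\<And>l. l \<in> M \<Longrightarrow> k m \<le> l m"
      using continuous_attains_inf[OF M(2,3) continuous_on_subset[OF cont subset_UNIV]] by blast
    define N where "N = M \<inter> {l. l m = k m}"
    have "closed {l::nat \<Rightarrow> real. l m = k m}"
      by (intro closed_Collect_eq cont continuous_intros)
    then have "compact N" unfolding N_def by (intro compact_Int_closed M)
    moreover have "N \<noteq> {}" "N \<subseteq> K" using k M by (auto simp: N_def)
    moreover have "l j \<le> u j" if "l \<in> N" "u \<in> K" "j < Suc m" "\<forall>i<j. u i = l i" for l u j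
    proof (cases "j < m")
      case True
      then show ?thesis using least that N_def by blast
    next
      case False
      then have "j = m" using that by simp
      then have "u \<in> M" using ext[of l u] that by (auto simp: N_def)
      then show ?thesis using k that \<open>j = m\<close> by (auto simp: N_def)
    qed
    moreover have "u \<in> N" if "l \<in> N" "u \<in> K" "\<forall>i<Suc m. u i = l i" for l u
      using ext[of l u] that by (auto simp: N_def)
    ultimately show ?case by (intro exI[of _ N]) blast
  qed
  from this[of n] obtain M where M: "M \<subseteq> K" "M \<noteq> {}"
    and least: "\<And>l u j. l \<in> M \<Longrightarrow> u \<in> K \<Longrightarrow> j < n \<Longrightarrow> (\<forall>i<j. u i = l i) \<Longrightarrow> l j \<le> u j"
    by metis
  then obtain l where l: "l \<in> M" by blast
  have "\<not> lex_less u l" if u: "u \<in> K" for u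
  proof
    assume "lex_less u l"
    then obtain j where j: "\<forall>i<j. u i = l i" "u j < l j" unfolding lex_less_def by blast
    have "j < n" using zero[of u j] zero[of l j] u l M(1) j(2) by (cases "j < n") auto
    then show False using least[OF l u _ j(1)] j(2) by simp
  qed
  then show ?thesis using l M unfolding lex_least_def by blast
qed

lemma compact_representations:
  fixes a :: "nat \<Rightarrow> 'e::euclidean_space"
  shows "compact (representations n a x t)"
proof -
  let ?B = "\<Pi>\<^sub>E i\<in>UNIV. {0..t}"
  let ?C = "{l::nat \<Rightarrow> real. \<forall>i\<ge>n. l i = 0} \<inter> {l. (\<Sum>i<n. l i) = t} \<inter> {l. (\<Sum>i<n. l i *\<^sub>R a i) = x}"
  have "compactin (product_topology (\<lambda>i. euclidean) UNIV) ?B"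
    unfolding compactin_PiE by simp
  then have B: "compact ?B"
    by (simp add: euclidean_product_topology)
  have *: "{l::nat \<Rightarrow> real. \<forall>i\<ge>n. l i = 0} = (\<Inter>i\<in>{n..}. {l. l i = 0})" by auto
  have "closed ?C"
    unfolding *
    by (intro closed_Int closed_INT ballI closed_Collect_eq continuous_intros
          continuous_on_product_coordinates)
  moreover have "representations n a x t = ?B \<inter> ?C"
  proof -
    have "l i \<le> t" if "l \<in> representations n a x t" for l i
    proof (cases "i < n")
      case True
      then have "l i \<le> (\<Sum>i<n. l i)"
        using that by (intro member_le_sum) (auto simp: representations_def)
      then show ?thesis using that by (simp add: representations_def)
    next
      case False
      have "0 \<le> (\<Sum>i<n. l i)" using that by (intro sum_nonneg) (auto simp: representations_def)
      then show ?thesis using that False by (auto simp: representations_def)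
    qed
    then show ?thesis by (auto simp: representations_def PiE_def Pi_def extensional_def)
  qed
  ultimately show ?thesis using compact_Int_closed[OF B] by simp
qed

text \<open>
  If \<open>m\<close> is a smaller representation, then \<open>m - l\<close> is an improving direction: where \<open>l\<close> vanishes it
  equals \<open>m\<close>, hence is nonnegative.  Conversely, \<open>l\<close> is bounded away from zero on its finite support,
  so a small multiple of an improving direction can be added to it.
\<close>

lemma lex_least_representation_iff:
  fixes a :: "nat \<Rightarrow> 'e::real_vector"
  assumes l: "l \<in> representations n a x t"
  shows "lex_least l (representations n a x t) \<longleftrightarrow> unimprovable n a (supp l)"
proof
  assume least: "lex_least l (representations n a x t)"
  show "unimprovable n a (supp l)"
    unfolding unimprovable_def
  proof (rule notI, elim exE conjE)
    fix r
    assume r: "\<forall>i\<ge>n. r i = 0" "(\<Sum>i<n. r i) = 0" "(\<Sum>i<n. r i *\<^sub>R a i) = 0"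
      "\<forall>i. i \<notin> supp l \<longrightarrow> 0 \<le> r i" "lex_less r (\<lambda>_. 0)"
    \<comment> \<open>The step \<open>e\<close> has to satisfy \<open>e * \<bar>r i\<bar> \<le> l i\<close> on the support; the summand 1 avoids division by
      zero and the element 1 keeps \<open>E\<close> nonempty when the support is empty.\<close>
    define E where "E = insert 1 ((\<lambda>i. l i / (\<bar>r i\<bar> + 1)) ` (supp l \<inter> {..<n}))"
    define e where "e = Min E"
    have E: "finite E" "E \<noteq> {}" by (auto simp: E_def)
    have lnn: "0 \<le> l i" for i using l by (simp add: representations_def)
    have "\<forall>y\<in>E. 0 < y"
      using lnn by (auto simp: E_def supp_def intro!: divide_pos_pos simp: less_le)
    then have e0: "0 < e" using E by (simp add: e_def)
    have nonneg: "0 \<le> l i + e * r i" for i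
    proof (cases "i \<in> supp l")
      case True
      then have "i < n" using l by (auto simp: supp_def representations_def not_less[symmetric])
      then have "e \<le> l i / (\<bar>r i\<bar> + 1)"
        unfolding e_def using E True by (intro Min_le) (auto simp: E_def)
      then have "e * (\<bar>r i\<bar> + 1) \<le> l i" by (simp add: pos_le_divide_eq)
      moreover have "e * - r i \<le> e * (\<bar>r i\<bar> + 1)" using e0 by (intro mult_left_mono) auto
      ultimately show ?thesis by simp
    next
      case False
      then show ?thesis using r(4) lnn e0 by simp
    qed
    let ?m = "\<lambda>i. l i + e * r i"
    have "(\<Sum>i<n. ?m i) = t"
      using l r(2) by (simp add: representations_def sum.distrib flip: sum_distrib_left)
    moreover have "(\<Sum>i<n. ?m i *\<^sub>R a i) = (\<Sum>i<n. l i *\<^sub>R a i) + e *\<^sub>R (\<Sum>i<n. r i *\<^sub>R a i)"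
      by (simp add: scaleR_add_left sum.distrib scaleR_right.sum)
    ultimately have "?m \<in> representations n a x t"
      using nonneg l r(1,3) by (auto simp: representations_def)
    moreover have "lex_less ?m l"
      using r(5) e0 unfolding lex_less_def by (auto simp: mult_pos_neg)
    ultimately show False using least unfolding lex_least_def by blast
  qed
next
  assume un: "unimprovable n a (supp l)"
  have "\<not> lex_less m l" if m: "m \<in> representations n a x t" for m
  proof
    assume less: "lex_less m l"
    let ?r = "\<lambda>i. m i - l i"
    have "\<forall>i\<ge>n. ?r i = 0" "(\<Sum>i<n. ?r i) = 0" "(\<Sum>i<n. ?r i *\<^sub>R a i) = 0"
      using l m by (auto simp: representations_def sum_subtractf scaleR_diff_left)
    moreover have "\<forall>i. i \<notin> supp l \<longrightarrow> 0 \<le> ?r i"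
      using m by (auto simp: representations_def supp_def)
    moreover have "lex_less ?r (\<lambda>_. 0)" using less unfolding lex_less_def by auto
    ultimately have "\<not> unimprovable n a (supp l)"
      unfolding unimprovable_def not_not by (intro exI[of _ ?r] conjI)
    then show False using un by contradiction
  qed
  then show "lex_least l (representations n a x t)" using l unfolding lex_least_def by blast
qed

lemma unique_unimprovable_representation:
  fixes a :: "nat \<Rightarrow> 'e::euclidean_space"
  assumes "representations n a x t \<noteq> {}"
  shows "\<exists>!l. l \<in> representations n a x t \<and> unimprovable n a (supp l)"
proof -
  have "\<exists>l. lex_least l (representations n a x t)"
    by (rule lex_least_exists[OF compact_representations assms, of n]) (auto simp: representations_def)
  then show ?thesis
    using lex_least_representation_iff lex_least_unique unfolding lex_least_def by metis
qed

lemma dilate_convex_hull_iff_representations: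
  fixes a :: "nat \<Rightarrow> 'e::real_vector"
  assumes inj: "inj_on a {..<n}" and t: "0 < t"
  shows "x \<in> (*\<^sub>R) t ` (convex hull (a ` {..<n})) \<longleftrightarrow> representations n a x t \<noteq> {}"
proof
  assume "x \<in> (*\<^sub>R) t ` (convex hull (a ` {..<n}))"
  then obtain u where u: "\<forall>y\<in>a ` {..<n}. 0 \<le> u y" "sum u (a ` {..<n}) = 1"
    "x = t *\<^sub>R (\<Sum>y\<in>a ` {..<n}. u y *\<^sub>R y)"
    by (auto simp: convex_hull_finite)
  have "(\<lambda>i. if i < n then t * u (a i) else 0) \<in> representations n a x t"
    using u t by (auto simp: representations_def sum.reindex[OF inj] o_def scaleR_right.sum
        simp flip: sum_distrib_left)
  then show "representations n a x t \<noteq> {}" by blast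
next
  assume "representations n a x t \<noteq> {}"
  then obtain l where l: "l \<in> representations n a x t" by blast
  have "(\<Sum>i<n. (l i / t) *\<^sub>R a i) \<in> convex hull (a ` {..<n})"
    using l t by (intro convex_sum convex_convex_hull hull_inc)
      (auto simp: representations_def simp flip: sum_divide_distrib)
  moreover have "x = t *\<^sub>R (\<Sum>i<n. (l i / t) *\<^sub>R a i)"
    using l t by (auto simp: representations_def scaleR_right.sum)
  ultimately show "x \<in> (*\<^sub>R) t ` (convex hull (a ` {..<n}))" by blast
qed

section \<open>Polynomial counting functions\<close>

definition polynomial_on_positives :: "(nat \<Rightarrow> rat) \<Rightarrow> bool" where
  "polynomial_on_positives f \<longleftrightarrow> (\<exists>q. \<forall>t>0. f t = poly q (of_nat t))"

lemma polynomial_on_positives_sum: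
  assumes "\<And>i. i \<in> I \<Longrightarrow> polynomial_on_positives (f i)"
  shows "polynomial_on_positives (\<lambda>t. \<Sum>i\<in>I. f i t)"
proof -
  have "\<forall>i\<in>I. \<exists>q. \<forall>t>0. f i t = poly q (of_nat t)"
    using assms unfolding polynomial_on_positives_def by blast
  then obtain q where "\<forall>i\<in>I. \<forall>t>0. f i t = poly (q i) (of_nat t)" by metis
  then have "\<forall>t>0. (\<Sum>i\<in>I. f i t) = poly (\<Sum>i\<in>I. q i) (of_nat t)" by (simp add: poly_sum)
  then show ?thesis unfolding polynomial_on_positives_def by blast
qed

text \<open>
  The hypothesis makes the truncated subtraction exact for all \<open>t > 0\<close>.
\<close>

lemma polynomial_on_positives_binomial:
  assumes "h \<le> Suc k"
  shows "polynomial_on_positives (\<lambda>t. of_nat ((t + k - h) choose k))"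
proof -
  let ?q = "smult (1 / fact k) (\<Prod>i<k. [:of_nat k - of_nat h - of_nat i, 1:]) :: rat poly"
  have "of_nat ((t + k - h) choose k) = poly ?q (of_nat t)" if "t > 0" for t
  proof -
    have "h \<le> t + k" using that assms by simp
    then have "(of_nat (t + k - h) :: rat) = of_nat t + of_nat k - of_nat h" by (simp add: of_nat_diff)
    then have "of_nat ((t + k - h) choose k) = ((of_nat t + of_nat k - of_nat h) gchoose k :: rat)"
      by (simp add: binomial_gbinomial)
    then show ?thesis
      by (simp add: gbinomial_prod_rev poly_prod atLeast0LessThan algebra_simps)
  qed
  then show ?thesis unfolding polynomial_on_positives_def by blast
qed

text \<open>
  Stars and bars: listing \<open>S\<close> turns these functions into lists of length \<open>card S\<close>.
\<close>

lemma card_functions_with_sum: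
  assumes "finite S"
  shows "card {m::'i \<Rightarrow> nat. (\<forall>i. i \<notin> S \<longrightarrow> m i = 0) \<and> sum m S = N} = (N + card S - 1) choose N"
proof -
  obtain xs where xs: "set xs = S" "distinct xs" using finite_distinct_list[OF assms] by blast
  let ?A = "{m::'i \<Rightarrow> nat. (\<forall>i. i \<notin> S \<longrightarrow> m i = 0) \<and> sum m S = N}"
  let ?B = "{l::nat list. length l = length xs \<and> sum_list l = N}"
  have sum: "sum_list (map m xs) = sum m S" for m :: "'i \<Rightarrow> nat"
    using xs by (simp add: sum_list_distinct_conv_sum_set)
  have "bij_betw (\<lambda>m. map m xs) ?A ?B"
    unfolding bij_betw_def
  proof (intro conjI)
    show "inj_on (\<lambda>m. map m xs) ?A"
    proof (rule inj_onI, rule ext)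
      fix m k i
      assume "m \<in> ?A" "k \<in> ?A" "map m xs = map k xs"
      then show "m i = k i" using xs by (cases "i \<in> S") auto
    qed
    show "(\<lambda>m. map m xs) ` ?A = ?B"
    proof (intro equalityI subsetI)
      fix l assume l: "l \<in> ?B"
      define m where "m = (\<lambda>i. case map_of (zip xs l) i of None \<Rightarrow> 0 | Some y \<Rightarrow> y)"
      have map: "map m xs = l"
      proof (rule nth_equalityI)
        fix j assume "j < length (map m xs)"
        then have "map_of (zip xs l) (xs ! j) = Some (l ! j)"
          using l xs by (intro map_of_zip_nth) auto
        then show "map m xs ! j = l ! j" using \<open>j < _\<close> by (simp add: m_def)
      qed (use l in simp)
      moreover have "m i = 0" if "i \<notin> S" for i
      proof -
        have "map_of (zip xs l) i = None"
          using that xs l by (simp add: map_of_zip_is_None)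
        then show ?thesis by (simp add: m_def)
      qed
      ultimately have "m \<in> ?A" using l sum[of m] by simp
      then show "l \<in> (\<lambda>m. map m xs) ` ?A" using map by blast
    qed (auto simp: sum)
  qed
  then have "card ?A = card ?B" by (rule bij_betw_same_card)
  moreover have "length xs = card S" using xs distinct_card[of xs] by simp
  ultimately show ?thesis by (simp add: card_length_sum_list)
qed

text \<open>
  The bound on \<open>h\<close> is what makes one polynomial valid for all \<open>t > 0\<close>: for \<open>0 < t < h\<close> there is
  nothing to count, and the binomial coefficient vanishes as well, its upper argument being a natural
  number smaller than the lower one.
\<close>

lemma polynomial_on_positives_card_functions_with_sum:
  assumes "finite S" and h: "h \<le> card S"
  shows "polynomial_on_positives
    (\<lambda>t. of_nat (card {m::'i \<Rightarrow> nat. (\<forall>i. i \<notin> S \<longrightarrow> m i = 0) \<and> h + sum m S = t}))"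
proof (cases "card S")
  case 0
  then have "S = {}" "h = 0" using assms by auto
  then have "card {m::'i \<Rightarrow> nat. (\<forall>i. i \<notin> S \<longrightarrow> m i = 0) \<and> h + sum m S = t} = 0" if "t > 0" for t
    using that by simp
  then show ?thesis
    unfolding polynomial_on_positives_def by (intro exI[of _ 0] allI impI) (simp only: of_nat_0 poly_0)
next
  case (Suc k)
  have "card {m::'i \<Rightarrow> nat. (\<forall>i. i \<notin> S \<longrightarrow> m i = 0) \<and> h + sum m S = t} = (t + k - h) choose k"
    if "t > 0" for t
  proof (cases "h \<le> t")
    case True
    then have "{m::'i \<Rightarrow> nat. (\<forall>i. i \<notin> S \<longrightarrow> m i = 0) \<and> h + sum m S = t} =
        {m. (\<forall>i. i \<notin> S \<longrightarrow> m i = 0) \<and> sum m S = t - h}" by auto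
    then show ?thesis
      using True Suc card_functions_with_sum[OF assms(1), of "t - h"]
        binomial_symmetric[of "t - h" "t + k - h"] by simp
  next
    case False
    then have "{m::'i \<Rightarrow> nat. (\<forall>i. i \<notin> S \<longrightarrow> m i = 0) \<and> h + sum m S = t} = {}" by auto
    moreover have "t + k - h < k" using False h Suc that by simp
    ultimately show ?thesis by (simp only: card.empty binomial_eq_0)
  qed
  then show ?thesis
    using polynomial_on_positives_binomial[of h k] h Suc
    unfolding polynomial_on_positives_def by simp
qed

section \<open>Integer points\<close>

lemma integer_points_add:
  assumes "x \<in> integer_points" and "y \<in> integer_points"
  shows "x + y \<in> integer_points"
  using assms by (auto simp: integer_points_def)

lemma integer_points_uminus_iff: "- x \<in> integer_points \<longleftrightarrow> x \<in> integer_points"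
  by (auto simp: integer_points_def minus_in_Ints_iff)

lemma integer_points_add_iff:
  assumes "z \<in> integer_points"
  shows "x + z \<in> integer_points \<longleftrightarrow> x \<in> integer_points"
  using integer_points_add[of "x + z" "- z"] integer_points_add[of x z] assms
  by (auto simp: integer_points_uminus_iff)

lemma integer_points_of_nat_scaleR:
  assumes "x \<in> integer_points"
  shows "real k *\<^sub>R x \<in> integer_points"
  using assms by (auto simp: integer_points_def)

lemma integer_points_sum_of_nat:
  assumes "\<And>i. i \<in> I \<Longrightarrow> a i \<in> integer_points"
  shows "(\<Sum>i\<in>I. real (m i) *\<^sub>R a i) \<in> integer_points"
  using assms by (auto simp: integer_points_def)

lemma finite_bounded_integer_points:
  fixes X :: "(real ^ 'd) set"
  assumes "bounded X"
  shows "finite (X \<inter> integer_points)"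
proof -
  obtain B where B: "\<And>x. x \<in> X \<Longrightarrow> norm x \<le> B" using assms by (auto simp: bounded_iff)
  let ?F = "PiE (UNIV :: 'd set) (\<lambda>_. {k \<in> \<int>. \<bar>k\<bar> \<le> B})"
  have "vec_nth ` (X \<inter> integer_points) \<subseteq> ?F"
    using B component_le_norm_cart order_trans
    by (fastforce simp: integer_points_def)
  moreover have "finite ?F" by (intro finite_PiE finite_abs_int_segment finite)
  ultimately have "finite (vec_nth ` (X \<inter> integer_points))" by (rule finite_subset)
  then show ?thesis
    by (rule finite_imageD) (auto simp: inj_on_def vec_eq_iff)
qed

lemma rational_points_common_denominator:
  fixes c :: "real ^ 'd"
  assumes "c \<in> rational_points"
  shows "\<exists>p>0. real p *\<^sub>R c \<in> integer_points"
proof -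
  have "\<exists>q>0. real q * c $ i \<in> \<int>" for i
  proof -
    have "c $ i \<in> \<rat>" using assms by (simp add: rational_points_def)
    then obtain u w where "w > 0" "c $ i = of_int u / of_int w" by (rule Rats_cases')
    then have "real (nat w) * c $ i = of_int u" by simp
    then show ?thesis using \<open>w > 0\<close> by (metis Ints_of_int zero_less_nat_eq)
  qed
  then obtain q where q: "\<And>i. q i > 0" "\<And>i. real (q i) * c $ i \<in> \<int>" by metis
  have "real (\<Prod>j\<in>UNIV. q j) * c $ i \<in> \<int>" for i
  proof -
    have "real (\<Prod>j\<in>UNIV. q j) * c $ i = real (\<Prod>j\<in>UNIV - {i}. q j) * (real (q i) * c $ i)"
      by (subst prod.remove[of UNIV i]) auto
    then show ?thesis using q(2)[of i] by (metis Ints_mult Ints_of_nat)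
  qed
  then show ?thesis using q(1) by (intro exI[of _ "\<Prod>j\<in>UNIV. q j"]) (auto simp: integer_points_def intro: prod_pos)
qed

section \<open>Translated dilates of a lattice polytope\<close>

definition translate_count :: "(real ^ 'd) set \<Rightarrow> real ^ 'd \<Rightarrow> nat \<Rightarrow> nat" where
  "translate_count P v t = card ((\<lambda>x. v + real t *\<^sub>R x) ` P \<inter> integer_points)"

text \<open>
  The canonical coefficient vectors of the integer points of all the sets \<open>v + t P\<close>, for real
  \<open>t \<ge> 0\<close>; the dilation factor is the sum of the coefficients.
\<close>

definition lattice_coefficients :: "nat \<Rightarrow> (nat \<Rightarrow> real ^ 'd) \<Rightarrow> real ^ 'd \<Rightarrow> (nat \<Rightarrow> real) set" where
  "lattice_coefficients n a v =
     {l. (\<forall>i. 0 \<le> l i) \<and> (\<forall>i\<ge>n. l i = 0) \<and> unimprovable n a (supp l) \<and>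
         v + (\<Sum>i<n. l i *\<^sub>R a i) \<in> integer_points}"

lemma lattice_coefficients_inj:
  assumes "l \<in> lattice_coefficients n a v" and "m \<in> lattice_coefficients n a v"
    and "(\<Sum>i<n. l i) = (\<Sum>i<n. m i)" and "(\<Sum>i<n. l i *\<^sub>R a i) = (\<Sum>i<n. m i *\<^sub>R a i)"
  shows "l = m"
proof -
  let ?R = "representations n a (\<Sum>i<n. l i *\<^sub>R a i) (\<Sum>i<n. l i)"
  have "l \<in> ?R" "m \<in> ?R" using assms by (auto simp: lattice_coefficients_def representations_def)
  moreover have "unimprovable n a (supp l)" "unimprovable n a (supp m)"
    using assms by (auto simp: lattice_coefficients_def)
  ultimately show ?thesis using unique_unimprovable_representation[of n a] by blast
qed

lemma translate_count_eq_card_lattice_coefficients: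
  assumes inj: "inj_on a {..<n}" and t: "0 < t"
  shows "translate_count (convex hull (a ` {..<n})) v t =
    card {l \<in> lattice_coefficients n a v. (\<Sum>i<n. l i) = real t}"
proof -
  let ?L = "{l \<in> lattice_coefficients n a v. (\<Sum>i<n. l i) = real t}"
  let ?X = "(\<lambda>x. v + real t *\<^sub>R x) ` (convex hull (a ` {..<n})) \<inter> integer_points"
  let ?f = "\<lambda>l. v + (\<Sum>i<n. l i *\<^sub>R a i)"
  have hull: "v + y \<in> (\<lambda>x. v + real t *\<^sub>R x) ` (convex hull (a ` {..<n})) \<longleftrightarrow>
      representations n a y (real t) \<noteq> {}" for y
    using dilate_convex_hull_iff_representations[OF inj, of "real t" y] t by auto
  have "bij_betw ?f ?L ?X"
    unfolding bij_betw_def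
  proof (intro conjI)
    show "inj_on ?f ?L" by (rule inj_onI) (auto intro: lattice_coefficients_inj)
    show "?f ` ?L = ?X"
    proof (intro equalityI subsetI)
      fix z assume "z \<in> ?f ` ?L"
      then obtain l where l: "l \<in> ?L" "z = ?f l" by blast
      then have "l \<in> representations n a (\<Sum>i<n. l i *\<^sub>R a i) (real t)"
        by (auto simp: lattice_coefficients_def representations_def)
      then have "z \<in> (\<lambda>x. v + real t *\<^sub>R x) ` (convex hull (a ` {..<n}))"
        unfolding l(2) hull by blast
      then show "z \<in> ?X" using l by (auto simp: lattice_coefficients_def)
    next
      fix z assume z: "z \<in> ?X"
      then have "representations n a (z - v) (real t) \<noteq> {}"
        using hull[of "z - v"] by simp
      then obtain l where l: "l \<in> representations n a (z - v) (real t)" "unimprovable n a (supp l)"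
        using unique_unimprovable_representation by blast
      then have "z = ?f l" "l \<in> ?L"
        using z by (auto simp: lattice_coefficients_def representations_def)
      then show "z \<in> ?f ` ?L" by blast
    qed
  qed
  then show ?thesis unfolding translate_count_def by (simp add: bij_betw_same_card)
qed

text \<open>
  On its support such a vector takes values in the half-open interval \<open>{0<..1}\<close>, so these vectors
  are points of half-open unit cubes, one for each unimprovable support.
\<close>

definition box_coefficients :: "nat \<Rightarrow> (nat \<Rightarrow> real ^ 'd) \<Rightarrow> real ^ 'd \<Rightarrow> (nat \<Rightarrow> real) set" where
  "box_coefficients n a v =
     {b \<in> lattice_coefficients n a v. (\<forall>i. b i \<le> 1) \<and> (\<Sum>i<n. b i) \<in> \<int>}"

text \<open>
  A canonical vector is determined by its combination of the \<open>a i\<close> and its sum.  Here these range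
  over the integer points of a bounded set and the integers in a bounded interval.
\<close>

lemma finite_box_coefficients: "finite (box_coefficients n a v)"
proof -
  let ?f = "\<lambda>b. (v + (\<Sum>i<n. b i *\<^sub>R a i), \<Sum>i<n. b i)"
  let ?X = "{v + (\<Sum>i<n. b i *\<^sub>R a i) | b. \<forall>i. 0 \<le> b i \<and> b i \<le> 1}"
  have "bounded ?X"
    unfolding bounded_iff
  proof (intro exI ballI)
    fix x assume "x \<in> ?X"
    then obtain b where b: "x = v + (\<Sum>i<n. b i *\<^sub>R a i)" "\<forall>i. 0 \<le> b i \<and> b i \<le> 1" by blast
    have "norm (\<Sum>i<n. b i *\<^sub>R a i) \<le> (\<Sum>i<n. norm (a i))"
    proof (rule sum_norm_le)
      fix i
      show "norm (b i *\<^sub>R a i) \<le> norm (a i)"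
        using b(2) mult_right_mono[of "b i" 1 "norm (a i)"] by simp
    qed
    then show "norm x \<le> norm v + (\<Sum>i<n. norm (a i))"
      unfolding b(1) using norm_triangle_ineq order_trans add_left_mono by blast
  qed
  then have fin: "finite ((?X \<inter> integer_points) \<times> {k \<in> \<int>. \<bar>k\<bar> \<le> real n})"
    by (intro finite_cartesian_product finite_bounded_integer_points finite_abs_int_segment)
  have "?f ` box_coefficients n a v \<subseteq> (?X \<inter> integer_points) \<times> {k \<in> \<int>. \<bar>k\<bar> \<le> real n}"
  proof (rule image_subsetI)
    fix b assume b: "b \<in> box_coefficients n a v"
    have "(\<Sum>i<n. b i) \<le> real n"
      using sum_bounded_above[of "{..<n}" b 1] b by (simp add: box_coefficients_def)
    moreover have "0 \<le> (\<Sum>i<n. b i)"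
      using b by (intro sum_nonneg) (simp add: box_coefficients_def lattice_coefficients_def)
    ultimately show "?f b \<in> (?X \<inter> integer_points) \<times> {k \<in> \<int>. \<bar>k\<bar> \<le> real n}"
      using b by (auto simp: box_coefficients_def lattice_coefficients_def)
  qed
  then have "finite (?f ` box_coefficients n a v)" using fin by (rule finite_subset)
  moreover have "inj_on ?f (box_coefficients n a v)"
    by (rule inj_onI) (auto simp: box_coefficients_def intro: lattice_coefficients_inj)
  ultimately show ?thesis by (rule finite_imageD)
qed

lemma supp_add_of_nat:
  fixes b :: "nat \<Rightarrow> real"
  assumes "\<forall>i. 0 \<le> b i" and "\<forall>i. i \<notin> supp b \<longrightarrow> m i = 0"
  shows "supp (\<lambda>i. b i + real (m i)) = supp b"
  using assms by (force simp: supp_def add_nonneg_eq_0_iff)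

lemma positive_box_decomposition_unique:
  fixes x y :: real
  assumes "x + real k = y + real l" and "0 < x" "x \<le> 1" "0 < y" "y \<le> 1"
  shows "k = l"
proof -
  have "real k < real l + 1" "real l < real k + 1" using assms by auto
  then show ?thesis by linarith
qed

text \<open>
  The bijection is \<open>(b, m) \<mapsto> b + m\<close>.  It stays within the canonical vectors because \<open>b\<close> and \<open>b + m\<close>
  have the same support, and it preserves integrality of the combination because the \<open>a i\<close> are
  integer points.
\<close>

lemma card_lattice_coefficients_eq_sum:
  fixes a :: "nat \<Rightarrow> real ^ 'd"
  assumes a: "\<And>i. i < n \<Longrightarrow> a i \<in> integer_points"
  shows "card {l \<in> lattice_coefficients n a v. (\<Sum>i<n. l i) = real t} =
    (\<Sum>b\<in>box_coefficients n a v.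
       card {m. (\<forall>i. i \<notin> supp b \<longrightarrow> m i = 0) \<and> (\<Sum>i<n. b i) + real (sum m (supp b)) = real t})"
    (is "card ?L = (\<Sum>b\<in>?B. card (?N b))")
proof -
  let ?f = "\<lambda>(b, m) i. b i + real (m i)"
  have supp_less: "supp b \<subseteq> {..<n}" if "b \<in> lattice_coefficients n a v" for b
    using that by (auto simp: supp_def lattice_coefficients_def not_le[symmetric])
  have sum_m: "sum m {..<n} = sum m (supp b)"
    if "b \<in> lattice_coefficients n a v" "\<forall>i. i \<notin> supp b \<longrightarrow> m i = 0" for b and m :: "nat \<Rightarrow> nat"
    using that supp_less by (intro sum.mono_neutral_right) auto
  have shift: "v + (\<Sum>i<n. (b i + real (m i)) *\<^sub>R a i) \<in> integer_points \<longleftrightarrow>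
      v + (\<Sum>i<n. b i *\<^sub>R a i) \<in> integer_points" for b and m :: "nat \<Rightarrow> nat"
    using integer_points_add_iff[of "\<Sum>i<n. real (m i) *\<^sub>R a i" "v + (\<Sum>i<n. b i *\<^sub>R a i)"]
      integer_points_sum_of_nat[of "{..<n}" a m] a
    by (simp add: scaleR_add_left sum.distrib add.assoc)
  have finN: "finite (?N b)" if "b \<in> ?B" for b
  proof -
    have "b \<in> lattice_coefficients n a v" using that by (simp add: box_coefficients_def)
    then have fs: "finite (supp b)" using supp_less finite_subset by blast
    have "?N b \<subseteq> (\<lambda>g i. if i \<in> supp b then g i else 0) ` (PiE (supp b) (\<lambda>_. {..t}))"
    proof
      fix m assume m: "m \<in> ?N b"
      have "0 \<le> (\<Sum>i<n. b i)"
        using that by (intro sum_nonneg) (simp add: box_coefficients_def lattice_coefficients_def)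
      moreover have "(\<Sum>i<n. b i) + real (sum m (supp b)) = real t" using m by blast
      ultimately have "sum m (supp b) \<le> t" by linarith
      then have "m i \<le> t" if "i \<in> supp b" for i
        using member_le_sum[OF that, of m] fs by simp
      then have "restrict m (supp b) \<in> PiE (supp b) (\<lambda>_. {..t})" by auto
      moreover have "m = (\<lambda>i. if i \<in> supp b then restrict m (supp b) i else 0)" using m by auto
      ultimately show "m \<in> (\<lambda>g i. if i \<in> supp b then g i else 0) ` (PiE (supp b) (\<lambda>_. {..t}))" by blast
    qed
    then show ?thesis by (rule finite_subset) (intro finite_imageI finite_PiE fs finite_atMost)
  qed
  have "bij_betw ?f (Sigma ?B ?N) ?L"
    unfolding bij_betw_def
  proof (intro conjI)
    show "inj_on ?f (Sigma ?B ?N)"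
    proof (rule inj_onI, clarify)
      fix b m b' m'
      assume b: "b \<in> ?B" "b' \<in> ?B"
        and m: "\<forall>i. i \<notin> supp b \<longrightarrow> m i = 0" "\<forall>i. i \<notin> supp b' \<longrightarrow> m' i = 0"
        and eq: "(\<lambda>i. b i + real (m i)) = (\<lambda>i. b' i + real (m' i))"
      have nn: "\<forall>i. 0 \<le> b i \<and> b i \<le> 1" "\<forall>i. 0 \<le> b' i \<and> b' i \<le> 1"
        using b by (auto simp: box_coefficients_def lattice_coefficients_def)
      have supp: "supp b = supp b'"
        using supp_add_of_nat[of b m] supp_add_of_nat[of b' m'] nn m eq by simp
      have mm: "m i = m' i" for i
      proof (cases "i \<in> supp b")
        case True
        then have "0 < b i" "0 < b' i" using supp nn by (auto simp: supp_def less_le)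
        then show ?thesis
          using positive_box_decomposition_unique[of "b i" "m i" "b' i" "m' i"] nn fun_cong[OF eq, of i]
          by simp
      next
        case False
        then show ?thesis using m supp by simp
      qed
      then have "b i = b' i" for i using fun_cong[OF eq, of i] by simp
      then show "b = b' \<and> m = m'" using mm by auto
    qed
    show "?f ` Sigma ?B ?N = ?L"
    proof (intro equalityI subsetI)
      fix l assume "l \<in> ?f ` Sigma ?B ?N"
      then obtain b m where b: "b \<in> ?B" and m: "m \<in> ?N b" and l: "l = (\<lambda>i. b i + real (m i))" by auto
      have bl: "b \<in> lattice_coefficients n a v" using b by (simp add: box_coefficients_def)
      have "supp l = supp b"
        unfolding l using bl m by (intro supp_add_of_nat) (auto simp: lattice_coefficients_def)
      moreover have "\<forall>i\<ge>n. l i = 0"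
        using bl m supp_less[OF bl] unfolding l by (auto simp: lattice_coefficients_def)
      ultimately have "l \<in> lattice_coefficients n a v"
        using bl shift[of b m] unfolding l by (auto simp: lattice_coefficients_def)
      moreover have "(\<Sum>i<n. l i) = real t"
        using m sum_m[OF bl, of m] unfolding l by (simp add: sum.distrib flip: of_nat_sum)
      ultimately show "l \<in> ?L" by simp
    next
      fix l assume l: "l \<in> ?L"
      \<comment> \<open>Rounding up and subtracting one, rather than rounding down, leaves a positive remainder for
        positive \<open>l i\<close>, so that the support does not shrink.\<close>
      define m where "m i = nat (\<lceil>l i\<rceil> - 1)" for i
      define b where "b i = l i - real (m i)" for i
      have l0: "0 \<le> l i" for i using l by (simp add: lattice_coefficients_def)
      have pos: "0 < b i \<and> b i \<le> 1" if "l i \<noteq> 0" for i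
      proof -
        have "0 < l i" using that l0[of i] by simp
        then have "0 < \<lceil>l i\<rceil>" by simp
        then have "real (m i) = of_int \<lceil>l i\<rceil> - 1" by (simp add: m_def)
        then show ?thesis unfolding b_def by linarith
      qed
      have zero: "m i = 0 \<and> b i = 0" if "l i = 0" for i using that by (simp add: m_def b_def)
      have supp: "supp b = supp l" using pos zero by (force simp: supp_def)
      have sum_bm: "b i + real (m i) = l i" for i by (simp add: b_def)
      then have lbm: "l = (\<lambda>i. b i + real (m i))" by simp
      have b0: "0 \<le> b i" for i using pos[of i] zero[of i] by (cases "l i = 0") auto
      have "v + (\<Sum>i<n. b i *\<^sub>R a i) \<in> integer_points"
        using l shift[of b m] by (simp add: sum_bm lattice_coefficients_def)
      then have bl: "b \<in> lattice_coefficients n a v"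
        using l supp zero b0 by (auto simp: lattice_coefficients_def)
      have mz: "\<forall>i. i \<notin> supp b \<longrightarrow> m i = 0" using zero unfolding supp by (simp add: supp_def)
      have "(\<Sum>i<n. l i) = (\<Sum>i<n. b i) + real (sum m (supp b))"
        using sum_m[OF bl mz] by (subst lbm) (simp add: sum.distrib flip: of_nat_sum)
      then have s: "(\<Sum>i<n. b i) + real (sum m (supp b)) = real t" using l by simp
      then have "(\<Sum>i<n. b i) = real t - real (sum m (supp b))" by simp
      then have "(\<Sum>i<n. b i) \<in> \<int>" by (metis Ints_diff Ints_of_nat)
      moreover have "b i \<le> 1" for i using pos[of i] zero[of i] by (cases "l i = 0") auto
      ultimately have "b \<in> ?B" using bl by (simp add: box_coefficients_def)
      moreover have "m \<in> ?N b" using mz s by simp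
      ultimately show "l \<in> ?f ` Sigma ?B ?N" using lbm by (intro image_eqI[of _ _ "(b, m)"]) auto
    qed
  qed
  then have "card ?L = card (Sigma ?B ?N)" by (simp only: bij_betw_same_card)
  also have "\<dots> = (\<Sum>b\<in>?B. card (?N b))"
    by (intro card_SigmaI finite_box_coefficients ballI finN)
  finally show ?thesis .
qed

text \<open>
  Apply the preceding count to the extreme points of \<open>P\<close>.  For a box vector \<open>b\<close> with sum \<open>h\<close>, the
  coordinates are at most 1, so \<open>h\<close> is at most the size of the support, which is the bound needed for
  polynomiality at all positive \<open>t\<close>.
\<close>

theorem translate_count_polynomial:
  fixes P :: "(real ^ 'd) set"
  assumes "lattice_polytope P"
  shows "polynomial_on_positives (\<lambda>t. of_nat (translate_count P v t))"
proof -
  let ?V = "{x. x extreme_point_of P}"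
  have P: "polytope P" "\<And>x. x \<in> ?V \<Longrightarrow> x \<in> integer_points"
    using assms by (auto simp: lattice_polytope_def)
  have fin: "finite ?V" using P by (intro finite_polyhedron_extreme_points polytope_imp_polyhedron)
  have hull: "P = convex hull ?V"
    using P by (intro Krein_Milman_Minkowski polytope_imp_compact polytope_imp_convex)
  obtain n and a :: "nat \<Rightarrow> real ^ 'd" where V: "?V = a ` {..<n}" and inj: "inj_on a {..<n}"
    using finite_imp_nat_seg_image_inj_on[OF fin] by (auto simp: lessThan_def)
  have a: "a i \<in> integer_points" if "i < n" for i using P(2) that V by blast
  let ?N = "\<lambda>b t. {m. (\<forall>i. i \<notin> supp b \<longrightarrow> m i = 0) \<and> (\<Sum>i<n. b i) + real (sum m (supp b)) = real t}"
  have "polynomial_on_positives (\<lambda>t. of_nat (card (?N b t)))" if b: "b \<in> box_coefficients n a v" for b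
  proof -
    have b': "\<forall>i. 0 \<le> b i" "\<forall>i. b i \<le> 1" "\<forall>i\<ge>n. b i = 0" "(\<Sum>i<n. b i) \<in> \<int>"
      using b by (auto simp: box_coefficients_def lattice_coefficients_def)
    then have sub: "supp b \<subseteq> {..<n}" by (auto simp: supp_def not_le[symmetric])
    have "0 \<le> (\<Sum>i<n. b i)" using b' by (intro sum_nonneg) simp
    then obtain h where h: "(\<Sum>i<n. b i) = real h"
      using b'(4) by (metis Ints_cases of_int_0_le_iff of_int_of_nat_eq zero_le_imp_eq_int)
    have "(\<Sum>i<n. b i) = sum b (supp b)"
      using sub by (intro sum.mono_neutral_right) (auto simp: supp_def)
    also have "\<dots> \<le> real (card (supp b))"
      using sum_bounded_above[of "supp b" b 1] b' by simp
    finally have "h \<le> card (supp b)" using h by simp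
    moreover have "?N b t = {m. (\<forall>i. i \<notin> supp b \<longrightarrow> m i = 0) \<and> h + sum m (supp b) = t}" for t
      unfolding h by (simp flip: of_nat_add del: of_nat_sum)
    ultimately show ?thesis
      using polynomial_on_positives_card_functions_with_sum[of "supp b" h] finite_subset[OF sub] by simp
  qed
  then have "polynomial_on_positives (\<lambda>t. \<Sum>b\<in>box_coefficients n a v. of_nat (card (?N b t)))"
    by (rule polynomial_on_positives_sum)
  moreover have "of_nat (translate_count P v t) =
      (\<Sum>b\<in>box_coefficients n a v. of_nat (card (?N b t)) :: rat)" if "t > 0" for t
    using translate_count_eq_card_lattice_coefficients[OF inj that, of v]
      card_lattice_coefficients_eq_sum[of n a v t] a
    by (subst hull) (simp only: V of_nat_sum)
  ultimately show ?thesis unfolding polynomial_on_positives_def by auto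
qed

lemma translate_count_add_integer_point:
  assumes "z \<in> integer_points"
  shows "translate_count P (v + z) t = translate_count P v t"
proof -
  have "(\<lambda>x. v + z + real t *\<^sub>R x) ` P \<inter> integer_points =
      (\<lambda>y. y + z) ` ((\<lambda>x. v + real t *\<^sub>R x) ` P \<inter> integer_points)"
    using integer_points_add_iff[OF assms] by (force simp: algebra_simps)
  then show ?thesis unfolding translate_count_def by (simp add: card_image)
qed

text \<open>
  The reflection \<open>x \<mapsto> w - x\<close> permutes the extreme points of \<open>P\<close>, so \<open>w\<close> is the sum of an extreme
  point and its mirror image.
\<close>

lemma centrally_symmetric_lattice_polytope_centre:
  fixes P :: "(real ^ 'd) set"
  assumes "lattice_polytope P" and "centrally_symmetric P"
  shows "\<exists>w\<in>integer_points. P = (\<lambda>x. w - x) ` P"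
proof -
  obtain w where w: "P = (\<lambda>x. w - x) ` P"
    using assms(2) by (auto simp: centrally_symmetric_def image_image)
  have "compact P" "convex P" "P \<noteq> {}" and V: "\<And>x. x extreme_point_of P \<Longrightarrow> x \<in> integer_points"
    using assms(1) by (auto simp: lattice_polytope_def polytope_imp_compact polytope_imp_convex)
  then obtain x where x: "x extreme_point_of P"
    using Krein_Milman_Minkowski[of P] by fastforce
  have "w - x extreme_point_of P"
    unfolding extreme_point_of_def
  proof (intro conjI ballI notI)
    show "w - x \<in> P" using x w by (auto simp: extreme_point_of_def)
    fix y z assume "y \<in> P" "z \<in> P" "w - x \<in> open_segment y z"
    moreover from this have "w - y \<in> P" "w - z \<in> P" using w by auto
    moreover have "x \<in> open_segment (w - y) (w - z)"
    proof -
      obtain u where u: "y \<noteq> z" "0 < u" "u < 1" "w - x = (1 - u) *\<^sub>R y + u *\<^sub>R z"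
        using \<open>w - x \<in> open_segment y z\<close> by (auto simp: in_segment)
      have "x = (1 - u) *\<^sub>R (w - y) + u *\<^sub>R (w - z)"
        using u(4) by (simp add: algebra_simps)
      then show ?thesis using u by (auto simp: in_segment)
    qed
    ultimately show False using x by (auto simp: extreme_point_of_def)
  qed
  then have "(w - x) + x \<in> integer_points" using V x integer_points_add by blast
  then show ?thesis using w by auto
qed

lemma translate_count_uminus:
  assumes "lattice_polytope P" and "centrally_symmetric P"
  shows "translate_count P (- v) t = translate_count P v t"
proof -
  obtain w where w: "w \<in> integer_points" and P: "P = (\<lambda>x. w - x) ` P"
    using centrally_symmetric_lattice_polytope_centre[OF assms] by blast
  define z where "z = real t *\<^sub>R w"
  have z: "z \<in> integer_points" unfolding z_def by (rule integer_points_of_nat_scaleR[OF w])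
  have int: "z - y \<in> integer_points \<longleftrightarrow> y \<in> integer_points" for y
    using integer_points_add_iff[OF z, of "- y"] by (simp add: integer_points_uminus_iff)
  have "(\<lambda>x. - v + real t *\<^sub>R x) ` P = (\<lambda>x. - v + real t *\<^sub>R (w - x)) ` P"
    by (subst P) (simp add: image_image)
  also have "\<dots> = (\<lambda>y. z - y) ` ((\<lambda>x. v + real t *\<^sub>R x) ` P)"
    by (simp add: image_image z_def algebra_simps)
  finally have "(\<lambda>x. - v + real t *\<^sub>R x) ` P \<inter> integer_points =
      (\<lambda>y. z - y) ` ((\<lambda>x. v + real t *\<^sub>R x) ` P \<inter> integer_points)"
    using int by auto
  then show ?thesis unfolding translate_count_def by (simp add: card_image inj_on_def)
qed

section \<open>Symmetry of the constituents\<close>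

lemma poly_eq_if_eq_on_progression:
  fixes p q :: "rat poly"
  assumes "N > 0" and "\<And>j. poly p (of_nat (r + N * j)) = poly q (of_nat (r + N * j))"
  shows "p = q"
proof (rule ccontr)
  assume "p \<noteq> q"
  then have "finite {x. poly (p - q) x = 0}" by (intro poly_roots_finite) simp
  moreover have "range (\<lambda>j. of_nat (r + N * j)) \<subseteq> {x. poly (p - q) x = 0}"
    using assms(2) by (auto simp del: of_nat_add of_nat_mult)
  ultimately have "finite (range (\<lambda>j. of_nat (r + N * j) :: rat))" using finite_subset by blast
  moreover have "inj (\<lambda>j. of_nat (r + N * j) :: rat)"
    using assms(1) by (auto simp: inj_on_def simp del: of_nat_add of_nat_mult)
  ultimately show False using finite_imageD by blast
qed

theorem corollary3p5:
  fixes P :: "(real ^ 'd) set" and c :: "real ^ 'd"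
  assumes "lattice_polytope P"
    and "centrally_symmetric P"
    and "c \<in> rational_points"
  shows "symmetric_quasi_polynomial (ehrhart ((+) c ` P))"
proof -
  define L where "L = ehrhart ((+) c ` P)"
  obtain p where p: "p > 0" "real p *\<^sub>R c \<in> integer_points"
    using rational_points_common_denominator[OF assms(3)] by blast
  have "\<forall>v. \<exists>f. \<forall>t>0. of_nat (translate_count P v t) = poly f (of_nat t :: rat)"
    using translate_count_polynomial[OF assms(1)] unfolding polynomial_on_positives_def by blast
  from choice[OF this]
  obtain F where F: "\<And>v t. t > 0 \<Longrightarrow> of_nat (translate_count P v t) = poly (F v) (of_nat t :: rat)"
    by blast
  have L_count: "L t = of_nat (translate_count P (real t *\<^sub>R c) t)" for t
    by (simp add: L_def ehrhart_def translate_count_def image_image scaleR_add_right)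
  have multiple: "real (p * j) *\<^sub>R c \<in> integer_points" for j
    using integer_points_of_nat_scaleR[OF p(2), of j] by (simp add: mult.commute)
  have L_residue: "L t = poly (F (real k *\<^sub>R c)) (of_nat t)" if "t > 0" "t = k + p * j" for t k j
  proof -
    have "real t *\<^sub>R c = real k *\<^sub>R c + real (p * j) *\<^sub>R c"
      unfolding that(2) by (simp only: of_nat_add scaleR_add_left)
    then show ?thesis
      using translate_count_add_integer_point[OF multiple, of P "real k *\<^sub>R c" j t] L_count F[OF that(1)]
      by simp
  qed
  have L_reflect: "L t = poly (F (real k *\<^sub>R c)) (of_nat t)" if "t > 0" "t + k = p * j" for t k j
  proof -
    have "real t + real k = real (p * j)" using that(2) by (metis of_nat_add)
    then have "real t = - real k + real (p * j)" by simp
    then have "real t *\<^sub>R c = - (real k *\<^sub>R c) + real (p * j) *\<^sub>R c"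
      by (simp only: scaleR_add_left scaleR_minus_left)
    then show ?thesis
      using translate_count_add_integer_point[OF multiple, of P "- (real k *\<^sub>R c)" j t]
        translate_count_uminus[OF assms(1,2), of "real k *\<^sub>R c" t] L_count F[OF that(1)]
      by simp
  qed
  have "has_constituents L p (\<lambda>k. F (real (k mod p) *\<^sub>R c))"
    unfolding has_constituents_def
  proof (intro conjI ballI allI impI)
    fix k t assume "t > 0" "[t = k] (mod p)"
    then have "t = k mod p + p * (t div p)" unfolding cong_def by (metis mod_mult_div_eq)
    then show "L t = poly (F (real (k mod p) *\<^sub>R c)) (of_nat t)" using L_residue \<open>t > 0\<close> by blast
  qed (use p in auto)
  then have period: "quasi_period L p" unfolding quasi_period_def by blast
  define q where "q = minimal_period L"
  have "quasi_period L q" unfolding q_def minimal_period_def using period by (rule LeastI)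
  then obtain g where g: "has_constituents L q g" unfolding quasi_period_def by blast
  then have q: "q > 0" and g0: "g 0 = g q"
    and gL: "\<And>k t. k \<in> {1..q} \<Longrightarrow> t > 0 \<Longrightarrow> [t = k] (mod q) \<Longrightarrow> L t = poly (g k) (of_nat t)"
    unfolding has_constituents_def by auto
  \<comment> \<open>Modulo \<open>q * p\<close>, the class of \<open>k\<close> lies in the class of \<open>k\<close> modulo both periods, and the class of
    \<open>- k\<close> in that of \<open>q - k\<close> modulo \<open>q\<close> and in that of \<open>- k\<close> modulo \<open>p\<close>.\<close>
  have "g k = g (q - k)" if "k \<le> q" for k
  proof (cases "0 < k \<and> k < q")
    case False
    then show ?thesis using that g0 by auto
  next
    case True
    have "g k = F (real k *\<^sub>R c)"
    proof (rule poly_eq_if_eq_on_progression[of "q * p" _ k])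
      fix j
      have "[k + q * p * j = k] (mod q)" by (simp add: cong_def mult.assoc)
      then show "poly (g k) (of_nat (k + q * p * j)) = poly (F (real k *\<^sub>R c)) (of_nat (k + q * p * j))"
        using gL[of k "k + q * p * j"] L_residue[of "k + q * p * j" k "q * j"] True
        by (simp add: mult_ac del: of_nat_add of_nat_mult)
    qed (use p q in simp)
    moreover have "g (q - k) = F (real k *\<^sub>R c)"
    proof (rule poly_eq_if_eq_on_progression[of "q * p" _ "q * p - k"])
      fix j
      let ?t = "q * p - k + q * p * j"
      have le: "q \<le> q * p" using p by simp
      then have "k < q * p" using True by linarith
      then have pos: "?t > 0" and "?t + k = q * p + q * p * j" by linarith+
      then have sum: "?t + k = p * (q * (j + 1))" by (simp add: algebra_simps)
      have "q * p - k = (q - k) + (q * p - q)" using le True by linarith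
      then have "?t = (q - k) + q * (p - 1 + p * j)"
        by (simp add: diff_mult_distrib2 add_mult_distrib2 mult.assoc)
      then have "[?t = q - k] (mod q)" by (simp only: cong_def mod_mult_self2)
      then show "poly (g (q - k)) (of_nat ?t) = poly (F (real k *\<^sub>R c)) (of_nat ?t)"
        using gL[of "q - k" ?t] L_reflect[OF pos sum] pos True by force
    qed (use p q in simp)
    ultimately show ?thesis by simp
  qed
  then show ?thesis
    using g period
    unfolding symmetric_quasi_polynomial_def quasi_polynomial_def q_def L_def by blast
qed

end
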